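(* Let $X\subset\mathbb{R}^N$ be a subset, regarded as a metric space with the Euclidean metric. (1) If $X$ is convex, then $H_n^{\Sigma,\ell}(X)=0$ for all integers $n>0$ and all real $\ell>0$. (2) If $X$ is an open subset of $\mathbb{R}^N$, then $H_n^{\Sigma,\ell}(X)=0$ for all integers $n>0$ and all real $\ell>0$.
   Context: Let $(X,d)$ be a metric space. For $x,y,z\in X$ write $x\prec y\prec z$ if $d(x,y)+d(y,z)=d(x,z)$, $x\neq y$ and $y\neq z$. A tuple $\boldsymbol{x}=(x_0,\dots,x_n)\in X^{n+1}$ is a proper chain of degree $n$ if $x_{i-1}\neq x_i$ for all $i=1,\dots,n$; its length is $|\boldsymbol{x}|=\sum_{i=1}^n d(x_{i-1},x_i)$. $P_n^{\ell}(X)$ is the set of proper chains of degree $n$ and length $\ell$. The magnitude chain complex in grading $\ell$ is $B_n^{\ell}(X)=\bigoplus_{\boldsymbol{x}\in P_n^{\ell}(X)}\mathbb{Z}\cdot\langle\boldsymbol{x}\rangle$ with boundary $\partial_n=\sum_i(-1)^i\partial_{n,i}$, where $\partial_{n,i}\langle x_0,\dots,x_n\rangle=\langle x_0,\dots,\widehat{x_i},\dots,x_n\rangle$ if $1\le i\le n-1$ and $x_{i-1}\prec x_i\prec x_{i+1}$, and $0$ otherwise. Its homology is the magnitude homology $H_n^{\Sigma,\ell}(X)$. *)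

theory Defs
  imports "HOL-Analysis.Analysis" "HOL-Algebra.Free_Abelian_Groups"
begin

definition strictly_between :: "'a::metric_space \<Rightarrow> 'a \<Rightarrow> 'a \<Rightarrow> bool" where
  "strictly_between x y z \<longleftrightarrow> dist x y + dist y z = dist x z \<and> x \<noteq> y \<and> y \<noteq> z"

(* The tuple (x_0, ..., x_n) is the list [x_0, ..., x_n], which has length n + 1.
   The metric on X is the restriction of the ambient distance. *)
definition chain_length :: "'a::metric_space list \<Rightarrow> real" where
  "chain_length xs = (\<Sum>i\<in>{1..<length xs}. dist (xs ! (i - 1)) (xs ! i))"

definition proper_chains :: "nat \<Rightarrow> real \<Rightarrow> 'a::metric_space set \<Rightarrow> 'a list set" where
  "proper_chains n l X =
     {xs. length xs = n + 1 \<and> set xs \<subseteq> X \<and>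
          (\<forall>i\<in>{1..n}. xs ! (i - 1) \<noteq> xs ! i) \<and> chain_length xs = l}"

definition magnitude_chain_group ::
    "nat \<Rightarrow> real \<Rightarrow> 'a::metric_space set \<Rightarrow> ('a list \<Rightarrow>\<^sub>0 int) monoid" where
  "magnitude_chain_group n l X = free_Abelian_group (proper_chains n l X)"

definition magnitude_face :: "nat \<Rightarrow> nat \<Rightarrow> 'a::metric_space list \<Rightarrow> ('a list \<Rightarrow>\<^sub>0 int)" where
  "magnitude_face n i xs =
     (if 1 \<le> i \<and> i < n \<and> strictly_between (xs ! (i - 1)) (xs ! i) (xs ! (i + 1))
      then frag_of (take i xs @ drop (i + 1) xs) else 0)"

definition magnitude_boundary ::
    "nat \<Rightarrow> ('a::metric_space list \<Rightarrow>\<^sub>0 int) \<Rightarrow> ('a list \<Rightarrow>\<^sub>0 int)" where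
  "magnitude_boundary n =
     frag_extend (\<lambda>xs. \<Sum>i\<le>n. frag_cmul ((-1) ^ i) (magnitude_face n i xs))"

(* For n = 0 the truncated index n - 1 = 0 is harmless: the boundary map in degree 0 is zero,
   so its kernel is the whole chain group. *)
definition magnitude_cycle_group ::
    "nat \<Rightarrow> real \<Rightarrow> 'a::metric_space set \<Rightarrow> ('a list \<Rightarrow>\<^sub>0 int) monoid" where
  "magnitude_cycle_group n l X =
     subgroup_generated (magnitude_chain_group n l X)
       (kernel (magnitude_chain_group n l X) (magnitude_chain_group (n - 1) l X)
          (magnitude_boundary n))"

definition magnitude_homology ::
    "nat \<Rightarrow> real \<Rightarrow> 'a::metric_space set \<Rightarrow> ('a list \<Rightarrow>\<^sub>0 int) set monoid" where
  "magnitude_homology n l X =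
     magnitude_cycle_group n l X Mod
       (magnitude_boundary (n + 1) ` carrier (magnitude_chain_group (n + 1) l X))"

end

theory Submission
  imports Defs
begin

text \<open>
  A cycle \<open>z\<close> involves finitely many chains, so for small \<open>e > 0\<close> every chain
  \<open>(x\<^sub>0, x\<^sub>1, \<dots>)\<close> in \<open>z\<close> can be extended to \<open>(x\<^sub>0, m, x\<^sub>1, \<dots>)\<close>, where \<open>m\<close> is the point at
  distance \<open>e\<close> from \<open>x\<^sub>0\<close> in the direction of \<open>x\<^sub>1\<close>. If \<open>x\<^sub>1\<close> lies between \<open>x\<^sub>0\<close> and \<open>x\<^sub>2\<close>, deleting it
  does not change that direction, so the extension \<open>h\<close> commutes with all faces up to an index
  shift, while deleting \<open>m\<close> gives back the original chain. Hence \<open>\<partial> (h z) = - z - h (\<partial> z) = - z\<close>.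
\<close>

section \<open>Directions as unit vectors, and betweenness in inner product spaces\<close>

lemma norm_scaleR_sgn: "norm w *\<^sub>R sgn w = w"
  by (cases "w = 0") (simp_all add: sgn_div_norm)

lemma sgn_add_of_sgn_eq:
  fixes u v :: "'a::real_normed_vector"
  assumes "sgn u = sgn v"
  shows "sgn (u + v) = sgn u"
proof (cases "u = 0")
  case False
  have "u + v = (norm u + norm v) *\<^sub>R sgn u"
    using norm_scaleR_sgn[of u] norm_scaleR_sgn[of v] assms by (simp add: scaleR_add_left)
  then have "sgn (u + v) = sgn (norm u + norm v) *\<^sub>R sgn (sgn u)"
    by (simp only: sgn_scaleR)
  moreover have "norm u + norm v > 0"
    using False by (simp add: add_pos_nonneg)
  ultimately show ?thesis
    using False by (simp add: sgn_div_norm[of "sgn u"] norm_sgn)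
qed (use assms in \<open>simp add: sgn_zero_iff\<close>)

text \<open>Both sides carry the factor \<open>norm u * norm v\<close>. This turns the equality
  condition in \<open>norm_triangle_eq\<close> into an equality of directions.\<close>

lemma norm_scaleR_swap_iff_sgn_eq:
  fixes u v :: "'a::real_normed_vector"
  assumes "u \<noteq> 0" "v \<noteq> 0"
  shows "norm u *\<^sub>R v = norm v *\<^sub>R u \<longleftrightarrow> sgn u = sgn v"
proof -
  have "norm u *\<^sub>R v = (norm u * norm v) *\<^sub>R sgn v"
    by (simp only: scaleR_scaleR[symmetric] norm_scaleR_sgn)
  moreover have "norm v *\<^sub>R u = (norm u * norm v) *\<^sub>R sgn u"
    by (simp only: mult.commute[of "norm u"] scaleR_scaleR[symmetric] norm_scaleR_sgn)
  ultimately show ?thesis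
    using assms by auto
qed

text \<open>The inner product enters here: its norm is strictly convex, so equality in the triangle
  inequality forces equal directions.\<close>

lemma strictly_between_iff_sgn_eq:
  fixes a b c :: "'a::real_inner"
  shows "strictly_between a b c \<longleftrightarrow> a \<noteq> b \<and> b \<noteq> c \<and> sgn (b - a) = sgn (c - b)"
proof (cases "a = b \<or> b = c")
  case False
  have "dist a b + dist b c = dist a c \<longleftrightarrow>
      norm ((b - a) + (c - b)) = norm (b - a) + norm (c - b)"
    by (simp add: dist_norm norm_minus_commute eq_commute)
  also have "\<dots> \<longleftrightarrow> sgn (b - a) = sgn (c - b)"
    unfolding norm_triangle_eq using False by (intro norm_scaleR_swap_iff_sgn_eq) auto
  finally show ?thesis
    using False by (simp add: strictly_between_def)
qed (auto simp: strictly_between_def)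

lemma sgn_diff_step:
  fixes a b :: "'a::real_normed_vector"
  assumes "e < dist a b"
  shows "sgn (b - (a + e *\<^sub>R sgn (b - a))) = sgn (b - a)"
proof (cases "a = b")
  case False
  have "b - (a + e *\<^sub>R sgn (b - a)) = (1 - e / norm (b - a)) *\<^sub>R (b - a)"
    by (simp add: sgn_div_norm algebra_simps divide_inverse)
  moreover have "1 - e / norm (b - a) > 0"
    using assms False by (simp add: dist_norm norm_minus_commute)
  ultimately show ?thesis
    by (simp only: sgn_scaleR) simp
qed simp

lemma strictly_between_step:
  fixes a b :: "'a::real_inner"
  assumes "0 < e" "e < dist a b"
  shows "strictly_between a (a + e *\<^sub>R sgn (b - a)) b"
proof -
  have "a \<noteq> b" using assms by auto
  moreover have "b \<noteq> a + e *\<^sub>R sgn (b - a)"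
    using assms sgn_diff_step[OF assms(2)] \<open>a \<noteq> b\<close>
    by (metis right_minus_eq sgn_zero_iff)
  ultimately show ?thesis
    using assms sgn_diff_step[OF assms(2)]
    by (auto simp: strictly_between_iff_sgn_eq sgn_scaleR sgn_zero_iff
        sgn_div_norm[of "sgn (b - a)"] norm_sgn)
qed

text \<open>The direction towards \<open>b\<close> is the same from \<open>a\<close> and from the
  inserted point, so inserting neither creates nor destroys the face that deletes
  \<open>b\<close>.\<close>

lemma strictly_between_from_step_iff:
  fixes a b c :: "'a::real_inner"
  assumes "0 < e" "e < dist a b"
  shows "strictly_between (a + e *\<^sub>R sgn (b - a)) b c \<longleftrightarrow> strictly_between a b c"
  using strictly_between_step[OF assms] sgn_diff_step[OF assms(2)] assms
  by (auto simp: strictly_between_iff_sgn_eq)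

text \<open>Here \<open>c - a\<close> is a sum of two vectors with the same direction. Hence a chain
  starting with \<open>a\<close>, \<open>b\<close>, \<open>c\<close> and its face without
  \<open>b\<close> receive the same inserted point.\<close>

lemma strictly_between_sgn_eq:
  fixes a b c :: "'a::real_inner"
  assumes "strictly_between a b c"
  shows "sgn (c - a) = sgn (b - a)"
  using sgn_add_of_sgn_eq[of "b - a" "c - b"] assms
  by (simp add: strictly_between_iff_sgn_eq)

section \<open>Inserting a point near the start of a chain\<close>

fun insert_step :: "real \<Rightarrow> 'a::real_normed_vector list \<Rightarrow> 'a list" where
  "insert_step e (a # b # xs) = a # (a + e *\<^sub>R sgn (b - a)) # b # xs"
| "insert_step e xs = xs"

lemma chain_length_Cons: "chain_length (a # b # xs) = dist a b + chain_length (b # xs)"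
proof -
  have "chain_length (a # b # xs) =
      dist a b + (\<Sum>i\<in>{Suc 1..<Suc (length (b # xs))}. dist ((a # b # xs) ! (i - 1)) ((a # b # xs) ! i))"
    unfolding chain_length_def by (simp add: sum.atLeast_Suc_lessThan)
  also have "(\<Sum>i\<in>{Suc 1..<Suc (length (b # xs))}. dist ((a # b # xs) ! (i - 1)) ((a # b # xs) ! i)) =
      chain_length (b # xs)"
    unfolding chain_length_def sum.shift_bounds_Suc_ivl
    by (intro sum.cong) (auto simp: nth_Cons')
  finally show ?thesis .
qed

lemma proper_chains_ConsE:
  assumes "xs \<in> proper_chains n l X" "0 < n"
  obtains a b ys where "xs = a # b # ys" "length ys = n - 1" "a \<noteq> b" "a \<in> X" "b \<in> X"
proof -
  from assms obtain a b ys where xs: "xs = a # b # ys" "length ys = n - 1"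
    by (cases xs; cases "tl xs") (auto simp: proper_chains_def)
  with assms have "xs ! 0 \<noteq> xs ! 1"
    by (auto simp: proper_chains_def dest: bspec[where x=1])
  with xs assms that show ?thesis
    by (auto simp: proper_chains_def)
qed

lemma insert_step_in_proper_chains:
  fixes a b :: "'a::real_inner"
  assumes ch: "a # b # ys \<in> proper_chains n l X"
    and e: "0 < e" "e < dist a b" and m: "a + e *\<^sub>R sgn (b - a) \<in> X"
  shows "insert_step e (a # b # ys) \<in> proper_chains (Suc n) l X"
proof -
  define m where "m = a + e *\<^sub>R sgn (b - a)"
  have sb: "strictly_between a m b"
    unfolding m_def by (rule strictly_between_step[OF e])
  have "(a # m # b # ys) ! (i - 1) \<noteq> (a # m # b # ys) ! i" if i: "i \<in> {1..Suc n}" for i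
  proof -
    \<comment> \<open>Indices 1 and 2 are the two gaps next to the inserted point; from 3 on, the
      gaps are those of the original chain shifted by one.\<close>
    consider "i = 1" | "i = 2" | "3 \<le> i"
      using i by fastforce
    then show ?thesis
    proof cases
      case 3
      then obtain k where k: "i = Suc (Suc (Suc k))"
        using le_Suc_ex[of 3 i] by auto
      then have "Suc (Suc k) \<in> {1..n}" using i by auto
      with ch have "(a # b # ys) ! (Suc (Suc k) - 1) \<noteq> (a # b # ys) ! Suc (Suc k)"
        unfolding proper_chains_def by blast
      then show ?thesis using k by simp
    qed (use sb in \<open>auto simp: strictly_between_def numeral_2_eq_2\<close>)
  qed
  moreover have "chain_length (a # m # b # ys) = chain_length (a # b # ys)"
    using sb by (simp add: chain_length_Cons strictly_between_def)
  ultimately show ?thesis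
    using ch m by (auto simp: proper_chains_def m_def)
qed

text \<open>Entries after the first move up by one, so face \<open>Suc i\<close> of the extension
  deletes the original entry \<open>i\<close>. For \<open>i = 0\<close> it deletes the inserted
  point, and \<open>magnitude_face n 0\<close> is zero.\<close>

lemma magnitude_face_insert_step:
  fixes a b :: "'a::real_inner"
  assumes e: "0 < e" "e < dist a b" and n: "length ys = n - 1" "0 < n"
  shows "magnitude_face (Suc n) (Suc i) (insert_step e (a # b # ys)) =
    (if i = 0 then frag_of (a # b # ys) else 0) +
    frag_extend (frag_of \<circ> insert_step e) (magnitude_face n i (a # b # ys))"
proof -
  consider "i = 0" | "i \<ge> n" "i \<noteq> 0" | "i = 1" "i < n" | k where "i = Suc (Suc k)" "i < n"
    by (metis One_nat_def not_less old.nat.exhaust)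
  then show ?thesis
  proof cases
    case 1
    then show ?thesis
      using n strictly_between_step[OF e] by (simp add: magnitude_face_def)
  next
    case 2
    then show ?thesis by (simp add: magnitude_face_def)
  next
    case 3
    then obtain c zs where "ys = c # zs"
      using n by (cases ys) auto
    \<comment> \<open>Deleting \<open>b\<close> removes the point that fixed the direction; if this
      face is nonzero, \<open>c\<close> gives the same direction.\<close>
    with 3 show ?thesis
      by (simp add: magnitude_face_def strictly_between_from_step_iff[OF e] strictly_between_sgn_eq)
  next
    case 4
    then show ?thesis by (simp add: magnitude_face_def)
  qed
qed

section \<open>The contraction formula and the filling of cycles\<close>

lemma magnitude_boundary_frag_of:
  "magnitude_boundary n (frag_of xs) = (\<Sum>i\<le>n. frag_cmul ((-1) ^ i) (magnitude_face n i xs))"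
  by (simp add: magnitude_boundary_def)

text \<open>The index shift reverses every sign, and the face deleting the inserted point has index
  1, hence sign -1.\<close>

lemma magnitude_boundary_insert_step:
  fixes a b :: "'a::real_inner"
  assumes e: "0 < e" "e < dist a b" and n: "length ys = n - 1" "0 < n"
  shows "magnitude_boundary (Suc n) (frag_of (insert_step e (a # b # ys))) =
    - frag_of (a # b # ys) -
    frag_extend (frag_of \<circ> insert_step e) (magnitude_boundary n (frag_of (a # b # ys)))"
proof -
  let ?x = "frag_of (a # b # ys)" and ?H = "frag_extend (frag_of \<circ> insert_step e)"
  have "magnitude_boundary (Suc n) (frag_of (insert_step e (a # b # ys))) =
    (\<Sum>i\<le>n. frag_cmul ((-1) ^ Suc i) (magnitude_face (Suc n) (Suc i) (insert_step e (a # b # ys))))"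
    unfolding magnitude_boundary_frag_of sum.atMost_Suc_shift by (simp add: magnitude_face_def)
  also have "\<dots> = (\<Sum>i\<le>n. (if i = 0 then - ?x else 0)
      - ?H (frag_cmul ((-1) ^ i) (magnitude_face n i (a # b # ys))))"
    by (intro sum.cong refl)
      (auto simp: magnitude_face_insert_step[OF e n] frag_cmul_distrib2 frag_extend_cmul
        simp del: insert_step.simps)
  also have "\<dots> = - ?x - ?H (magnitude_boundary n ?x)"
    by (simp add: sum_subtractf magnitude_boundary_frag_of frag_extend_sum)
  finally show ?thesis .
qed

lemma magnitude_boundary_simps [simp]:
  "magnitude_boundary n 0 = 0"
  "magnitude_boundary n (- x) = - magnitude_boundary n x"
  "magnitude_boundary n (x + y) = magnitude_boundary n x + magnitude_boundary n y"
  "magnitude_boundary n (x - y) = magnitude_boundary n x - magnitude_boundary n y"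
  by (simp_all add: magnitude_boundary_def frag_extend_minus frag_extend_add frag_extend_diff)

lemma cycle_is_boundary:
  fixes X :: "'a::real_inner set"
  assumes X: "\<And>a b. a \<in> X \<Longrightarrow> b \<in> X \<Longrightarrow> a \<noteq> b \<Longrightarrow>
      \<forall>\<^sub>F e in at_right 0. a + e *\<^sub>R sgn (b - a) \<in> X"
    and n: "0 < n"
    and z: "Poly_Mapping.keys z \<subseteq> proper_chains n l X" "magnitude_boundary n z = 0"
  shows "z \<in> magnitude_boundary (n + 1) ` carrier (magnitude_chain_group (n + 1) l X)"
proof -
  define good where "good e xs \<longleftrightarrow> (\<exists>a b ys. xs = a # b # ys \<and> length ys = n - 1 \<and>
      0 < e \<and> e < dist a b \<and> a + e *\<^sub>R sgn (b - a) \<in> X)" for e xs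
  have "\<forall>\<^sub>F e in at_right 0. good e xs" if xs_in: "xs \<in> Poly_Mapping.keys z" for xs
  proof -
    obtain a b ys where xs: "xs = a # b # ys" "length ys = n - 1" "a \<noteq> b" "a \<in> X" "b \<in> X"
      by (rule proper_chains_ConsE[OF subsetD[OF z(1) xs_in] n])
    have "\<forall>\<^sub>F e in at_right 0. e \<in> {0<..<dist a b}"
      using xs by (intro eventually_at_right_real) simp
    with X[OF xs(4,5,3)] show ?thesis
      by eventually_elim (use xs in \<open>auto simp: good_def\<close>)
  qed
  \<comment> \<open>Finiteness of the support of \<open>z\<close> yields one \<open>e\<close> for
    all its chains.\<close>
  then have "\<forall>\<^sub>F e in at_right 0. \<forall>xs\<in>Poly_Mapping.keys z. good e xs"
    by (simp add: eventually_ball_finite)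
  then obtain e where e: "\<And>xs. xs \<in> Poly_Mapping.keys z \<Longrightarrow> good e xs"
    using eventually_happens'[OF trivial_limit_at_right_real] by blast
  let ?H = "frag_extend (frag_of \<circ> insert_step e)"
  have "magnitude_boundary (Suc n) (?H z) = - z - ?H (magnitude_boundary n z)"
  \<comment> \<open>Both sides are linear in \<open>z\<close>. Inducting over the support of
    \<open>z\<close> itself keeps \<open>e\<close> valid for every generator.\<close>
  proof (induction z rule: frag_induction[OF subset_refl])
    case (2 xs)
    then obtain a b ys where "xs = a # b # ys" "length ys = n - 1" "0 < e" "e < dist a b"
      using e unfolding good_def by blast
    with n show ?case
      by (simp only: magnitude_boundary_insert_step frag_extend_of o_apply[of _ _ xs] o_apply[of _ _ "a # b # ys"])
  qed (simp_all add: frag_extend_diff)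
  then have "z = magnitude_boundary (n + 1) (- ?H z)"
    using z by simp
  moreover have "insert_step e xs \<in> proper_chains (Suc n) l X" if "xs \<in> Poly_Mapping.keys z" for xs
    using e[OF that] subsetD[OF z(1) that] insert_step_in_proper_chains unfolding good_def by blast
  then have "Poly_Mapping.keys (?H z) \<subseteq> proper_chains (Suc n) l X"
    using keys_frag_extend[of "frag_of \<circ> insert_step e" z] by auto
  ultimately show ?thesis
    by (intro image_eqI[where x = "- ?H z"]) (simp_all add: magnitude_chain_group_def)
qed

section \<open>From filled cycles to trivial homology\<close>

text \<open>
  If the boundaries contain all cycles, then the only coset is the set of boundaries itself.
  Hence the quotient is trivial without appeal to \<open>\<partial> \<circ> \<partial> = 0\<close>.
\<close>

lemma trivial_magnitude_homologyI:
  assumes "\<And>z. Poly_Mapping.keys z \<subseteq> proper_chains n l X \<Longrightarrow> magnitude_boundary n z = 0 \<Longrightarrow>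
    z \<in> magnitude_boundary (n + 1) ` carrier (magnitude_chain_group (n + 1) l X)"
  shows "trivial_group (magnitude_homology n l X)"
proof -
  define B where "B = magnitude_boundary (n + 1) ` carrier (magnitude_chain_group (n + 1) l X)"
  let ?G = "magnitude_chain_group n l X" and ?Z = "magnitude_cycle_group n l X"
  let ?K = "kernel ?G (magnitude_chain_group (n - 1) l X) (magnitude_boundary n)"
  have add: "x + y \<in> B" if "x \<in> B" "y \<in> B" for x y
  proof -
    obtain u v where "x = magnitude_boundary (n + 1) u" "y = magnitude_boundary (n + 1) v"
      "u \<in> carrier (magnitude_chain_group (n + 1) l X)"
      "v \<in> carrier (magnitude_chain_group (n + 1) l X)"
      using \<open>x \<in> B\<close> \<open>y \<in> B\<close> by (auto simp: B_def)
    then show ?thesis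
      using keys_add[of u v] unfolding B_def
      by (intro image_eqI[where x = "u + v"]) (auto simp: magnitude_chain_group_def)
  qed
  have minus: "- x \<in> B" if "x \<in> B" for x
    using that unfolding B_def magnitude_chain_group_def
    by (force simp: keys_minus intro: image_eqI[where x = "- _"])
  have zero: "0 \<in> B"
    unfolding B_def magnitude_chain_group_def by (force intro: image_eqI[where x = 0])
  \<comment> \<open>The cycle group is encoded as generated by the kernel; the kernel is closed
    under the operations, so every generated element is still a cycle.\<close>
  have "x \<in> carrier ?G \<and> magnitude_boundary n x = 0" if "x \<in> generate ?G (carrier ?G \<inter> ?K)" for x
    using that
  proof induction
    case (eng h1 h2)
    then show ?case
      using keys_add[of h1 h2] by (auto simp: magnitude_chain_group_def)
  qed (auto simp: magnitude_chain_group_def kernel_def keys_minus)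
  then have Z: "carrier ?Z \<subseteq> B"
    using assms unfolding magnitude_cycle_group_def carrier_subgroup_generated B_def
    by (auto simp: magnitude_chain_group_def)
  have mult: "x \<otimes>\<^bsub>?Z\<^esub> y = x + y" for x y
    by (simp add: magnitude_cycle_group_def magnitude_chain_group_def)
  have coset: "B #>\<^bsub>?Z\<^esub> a = B" if "a \<in> B" for a
  proof -
    have "x \<in> (\<lambda>h. h + a) ` B" if "x \<in> B" for x
      using add[OF that minus[OF \<open>a \<in> B\<close>]] by (force intro: image_eqI[where x = "x + - a"])
    then show ?thesis
      using add that by (auto simp: r_coset_def mult)
  qed
  \<comment> \<open>At least one coset exists, so the carrier of the quotient is \<open>{B}\<close>
    and not empty.\<close>
  have "0 \<in> carrier ?Z"
    using generate.one[of ?G "carrier ?G \<inter> ?K"]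
    unfolding magnitude_cycle_group_def carrier_subgroup_generated
    by (simp add: magnitude_chain_group_def)
  then have carr: "carrier (?Z Mod B) = {B}"
    using Z coset unfolding carrier_FactGroup by blast
  have "B <#>\<^bsub>?Z\<^esub> B = (\<Union>a\<in>B. B #>\<^bsub>?Z\<^esub> a)"
    by (auto simp: set_mult_def r_coset_def)
  then have "B <#>\<^bsub>?Z\<^esub> B = B"
    using coset zero by auto
  then have "trivial_group (?Z Mod B)"
    using carr unfolding trivial_group_def by (auto intro!: groupI)
  then show ?thesis
    by (simp only: magnitude_homology_def B_def)
qed

section \<open>Small steps inside convex and open sets\<close>

text \<open>For \<open>e < dist a b\<close> the step ends on the segment from \<open>a\<close> to
  \<open>b\<close>, at the fraction \<open>e / norm (b - a)\<close>.\<close>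

lemma convex_eventually_step_mem:
  fixes a b :: "'a::real_normed_vector"
  assumes "convex X" "a \<in> X" "b \<in> X" "a \<noteq> b"
  shows "\<forall>\<^sub>F e in at_right 0. a + e *\<^sub>R sgn (b - a) \<in> X"
proof -
  have "\<forall>\<^sub>F e in at_right 0. e \<in> {0<..<dist a b}"
    using assms by (intro eventually_at_right_real) simp
  then show ?thesis
  proof eventually_elim
    case (elim e)
    define t where "t = e / norm (b - a)"
    have "0 \<le> t" "t \<le> 1"
      using elim assms by (auto simp: t_def dist_norm norm_minus_commute divide_simps)
    moreover have "a + e *\<^sub>R sgn (b - a) = (1 - t) *\<^sub>R a + t *\<^sub>R b"
      by (simp add: t_def sgn_div_norm algebra_simps divide_inverse)
    ultimately show ?case
      using assms by (simp add: convexD_alt)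
  qed
qed

text \<open>The points tend to \<open>a\<close> as \<open>e\<close> tends to 0; further on, the ray
  may leave \<open>X\<close>.\<close>

lemma open_eventually_step_mem:
  fixes a v :: "'a::real_normed_vector"
  assumes "open X" "a \<in> X"
  shows "\<forall>\<^sub>F e in at_right 0. a + e *\<^sub>R v \<in> X"
proof -
  have "((\<lambda>e. a + e *\<^sub>R v) \<longlongrightarrow> a + 0 *\<^sub>R v) (at_right 0)"
    by (intro tendsto_intros)
  then show ?thesis
    using assms by (intro topological_tendstoD) auto
qed

theorem corollary5p3:
  fixes X :: "(real ^ 'N) set"
  shows "(convex X \<longrightarrow>
            (\<forall>(n::nat) (l::real). 0 < n \<longrightarrow> 0 < l \<longrightarrow> trivial_group (magnitude_homology n l X))) \<and>
         (open X \<longrightarrow>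
            (\<forall>(n::nat) (l::real). 0 < n \<longrightarrow> 0 < l \<longrightarrow> trivial_group (magnitude_homology n l X)))"
proof (intro conjI impI allI)
  fix n :: nat and l :: real
  assume "convex X" "0 < n"
  then show "trivial_group (magnitude_homology n l X)"
    by (intro trivial_magnitude_homologyI cycle_is_boundary convex_eventually_step_mem)
next
  fix n :: nat and l :: real
  assume "open X" "0 < n"
  then show "trivial_group (magnitude_homology n l X)"
    by (intro trivial_magnitude_homologyI cycle_is_boundary open_eventually_step_mem)
qed

end
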